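(* Let $p\ge2$, let $f\in\mathcal H_0$, let $u$ solve the gradient flow $\partial_tu+\partial J(u)\ni0$, $u(0)=f$, set $\lambda:=\lambda_1\|f\|^{p-2}$, let $a(t)=(1+(p-2)\lambda t)^{-\frac1{p-2}}$ if $p>2$ and $a(t)=e^{-\lambda t}$ if $p=2$, and let $w(t):=u(t)/a(t)$ for $t\ge0$. Assume that there are $w_*\in\mathcal H$ and a sequence $t_k\to\infty$ with $w(t_k)\to w_*$ strongly in $\mathcal H$ (or that $w(t)\to w_*$ strongly as $t\to\infty$). Then $\lambda w_*\in\partial J(w_* )$, and $w_*\ne0$ if $p>2$.
   Context: $\mathcal H$ is a real Hilbert space with inner product $\langle\cdot,\cdot\rangle$ and norm $\|\cdot\|$. $J:\mathcal H\to\mathbb R\cup\{\infty\}$ is convex, lower semicontinuous, proper, with dense effective domain, and absolutely $p$-homogeneous: $J(cu)=|c|^pJ(u)$ for $c\ne0$ and $J(0)=0$. Standing coercivity assumption: $\lambda_1:=\inf_{u\in\mathcal H_0}pJ(u)/\|u\|^p>0$. $\partial J(u)=\{\zeta: J(u)+\langle\zeta,v-u\rangle\le J(v)\ \forall v\}$; $\mathcal N(J)=\{u:J(u)=0\}$; $\mathcal H_0:=\mathcal N(J)^\perp\setminus\{0\}$. The gradient flow solution (Brezis) is the unique continuous $u:[0,\infty)\to\mathcal H$, Lipschitz on $[\delta,\infty)$ for all $\delta>0$, right-differentiable on $(0,\infty)$ with $u(0)=f$ and $\partial_t^+u(t)=-\zeta(t)$, $\zeta(t)$ the minimal-norm element of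 $\partial J(u(t))$. The function $a$ is the solution of $a'=-\lambda a^{p-1}$, $a(0)=1$. *)

theory Defs
  imports "HOL-Analysis.Analysis"
begin

text \<open>Functionals J : H -> R \<union> {\<infinity>} are modelled as ereal-valued functions never taking -\<infinity>.\<close>

definition convex_fun :: "('a::real_vector \<Rightarrow> ereal) \<Rightarrow> bool" where
  "convex_fun J \<longleftrightarrow> (\<forall>x y. \<forall>\<theta>::real. 0 \<le> \<theta> \<and> \<theta> \<le> 1 \<longrightarrow>
      J ((1 - \<theta>) *\<^sub>R x + \<theta> *\<^sub>R y) \<le> ereal (1 - \<theta>) * J x + ereal \<theta> * J y)"

definition lsc_fun :: "('a::topological_space \<Rightarrow> ereal) \<Rightarrow> bool" where
  "lsc_fun J \<longleftrightarrow> (\<forall>x. \<forall>c. c < J x \<longrightarrow> (\<forall>\<^sub>F y in at x. c < J y))"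

definition proper_fun :: "('a \<Rightarrow> ereal) \<Rightarrow> bool" where
  "proper_fun J \<longleftrightarrow> (\<forall>u. J u \<noteq> -\<infinity>) \<and> (\<exists>u. J u \<noteq> \<infinity>)"

definition dom_fun :: "('a \<Rightarrow> ereal) \<Rightarrow> 'a set" where
  "dom_fun J = {u. J u < \<infinity>}"

definition abs_homogeneous :: "real \<Rightarrow> ('a::real_vector \<Rightarrow> ereal) \<Rightarrow> bool" where
  "abs_homogeneous p J \<longleftrightarrow> J 0 = 0 \<and> (\<forall>c u. c \<noteq> 0 \<longrightarrow> J (c *\<^sub>R u) = ereal (\<bar>c\<bar> powr p) * J u)"

definition subdiff :: "('a::real_inner \<Rightarrow> ereal) \<Rightarrow> 'a \<Rightarrow> 'a set" where
  "subdiff J u = {\<zeta>. \<forall>v. J u + ereal (\<zeta> \<bullet> (v - u)) \<le> J v}"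

definition null_set :: "('a \<Rightarrow> ereal) \<Rightarrow> 'a set" where
  "null_set J = {u. J u = 0}"

definition H0 :: "('a::real_inner \<Rightarrow> ereal) \<Rightarrow> 'a set" where
  "H0 J = {u. \<forall>v \<in> null_set J. u \<bullet> v = 0} - {0}"

definition lambda1 :: "real \<Rightarrow> ('a::real_inner \<Rightarrow> ereal) \<Rightarrow> ereal" where
  "lambda1 p J = (INF u \<in> H0 J. ereal p * J u / ereal (norm u powr p))"

definition min_norm_elem :: "'a::real_normed_vector set \<Rightarrow> 'a \<Rightarrow> bool" where
  "min_norm_elem S z \<longleftrightarrow> z \<in> S \<and> (\<forall>y \<in> S. norm z \<le> norm y)"

text \<open>Brezis gradient flow solution of u' + dJ(u) \<ni> 0, u(0) = f (only the values on [0,\<infinity>) matter).\<close>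
definition grad_flow :: "('a::real_inner \<Rightarrow> ereal) \<Rightarrow> 'a \<Rightarrow> (real \<Rightarrow> 'a) \<Rightarrow> bool" where
  "grad_flow J f u \<longleftrightarrow>
     continuous_on {0..} u \<and>
     (\<forall>\<delta>>0. \<exists>L. \<forall>s\<in>{\<delta>..}. \<forall>t\<in>{\<delta>..}. dist (u s) (u t) \<le> L * dist s t) \<and>
     u 0 = f \<and>
     (\<forall>t>0. \<exists>z. min_norm_elem (subdiff J (u t)) z \<and>
              (u has_vector_derivative (- z)) (at t within {t..}))"

end

theory Submission
  imports Defs
begin

text \<open>In the logarithmic time \<open>s\<close> with \<open>a(t) = exp(-\<lambda>s)\<close> the rescaled solution \<open>W(s) = w(t)\<close> solves
  \<open>W' \<in> \<lambda>W - \<partial>J(W)\<close>, the gradient flow of \<open>G = J - \<lambda>/2 |\<cdot>|\<^sup>2\<close>. The variational inequality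
  \<open>d/ds |W - v|\<^sup>2/2 \<le> G(v) - G(W) + \<lambda>/2 |W - v|\<^sup>2\<close> implies that \<open>G(W)\<close> decreases, to a limit \<open>g\<close>
  if \<open>W(s\<^sub>k) \<rightarrow> w\<^sub>*\<close>. By Gronwall with \<open>v = W(s\<^sub>k)\<close> also \<open>W(s\<^sub>k + 1) \<rightarrow> w\<^sub>*\<close>, and Gronwall for arbitrary
  \<open>v\<close> on \<open>[s\<^sub>k, s\<^sub>k + 1]\<close> then yields \<open>G(w\<^sub>*) \<le> g \<le> G(v) + \<lambda>/2 |w\<^sub>* - v|\<^sup>2\<close>, which is the eigenvector
  relation. For \<open>w\<^sub>* \<noteq> 0\<close> the same monotonicity is used with a larger \<open>\<lambda>\<close>, for which the energy starts
  out negative.\<close>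

section \<open>Monotonicity from one-sided derivative bounds\<close>

text \<open>For each slope \<open>e > 0\<close>, the supremum of the points with
  \<open>F x \<le> F a + e * (x - a)\<close> satisfies this bound itself by lower semicontinuity,
  and the Dini hypothesis leads past it unless it equals \<open>b\<close>; then \<open>e\<close>
  tends to 0. Lower semicontinuity is what the energy along the flow inherits from
  \<open>J\<close>.\<close>

lemma lower_Dini_imp_le:
  fixes F :: "real \<Rightarrow> real"
  assumes ab: "a \<le> b"
    and lsc: "\<And>x c. x \<in> {a..b} \<Longrightarrow> c < F x \<Longrightarrow> \<forall>\<^sub>F y in at x within {a..b}. c < F y"
    and dini: "\<And>x e. a \<le> x \<Longrightarrow> x < b \<Longrightarrow> e > 0 \<Longrightarrow> \<exists>y\<in>{x<..b}. F y \<le> F x + e * (y - x)"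
  shows "F b \<le> F a"
proof -
  have "F b \<le> F a + e * (b - a)" if e: "e > 0" for e
  proof -
    define S where "S = {x \<in> {a..b}. F x \<le> F a + e * (x - a)}"
    have aS: "a \<in> S" and bdd: "bdd_above S"
      using ab unfolding S_def by auto
    define m where "m = Sup S"
    have up: "x \<le> m" if "x \<in> S" for x
      unfolding m_def using that bdd by (rule cSup_upper)
    have am: "a \<le> m" using up[OF aS] .
    have mb: "m \<le> b" unfolding m_def
      using aS by (intro cSup_least) (auto simp: S_def)
    have mS: "m \<in> S"
    proof (rule ccontr)
      assume nS: "m \<notin> S"
      then have gt: "F m > F a + e * (m - a)" using am mb by (auto simp: S_def)
      then have "\<forall>\<^sub>F y in at m within {a..b}. F a + e * (m - a) < F y"
        using am mb by (intro lsc) auto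
      then obtain d where d: "d > 0"
        and dF: "\<And>y. y \<in> {a..b} \<Longrightarrow> y \<noteq> m \<Longrightarrow> dist y m < d \<Longrightarrow> F a + e * (m - a) < F y"
        unfolding eventually_at by blast
      obtain x where x: "x \<in> S" "m - d < x"
        using less_cSup_iff[of S "m - d"] aS bdd d unfolding m_def by auto
      have "x \<le> m" "x \<noteq> m" using up x nS by auto
      then have "F a + e * (m - a) < F x"
        using x d by (intro dF) (auto simp: S_def dist_real_def)
      also have "F x \<le> F a + e * (x - a)" using x by (simp add: S_def)
      finally show False using e \<open>x \<le> m\<close> by simp
    qed
    have "m = b"
    proof (rule ccontr)
      assume "m \<noteq> b"
      then obtain y where y: "m < y" "y \<le> b" "F y \<le> F m + e * (y - m)"
        using dini[of m e] am mb e by auto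
      then have "F y \<le> F a + e * (y - a)" using mS by (simp add: S_def algebra_simps)
      then have "y \<in> S" using y am by (simp add: S_def)
      then show False using up y by fastforce
    qed
    then show ?thesis using mS by (simp add: S_def)
  qed note * = this
  show ?thesis
  proof (rule ccontr)
    assume "\<not> F b \<le> F a"
    then have lt: "F a < F b" by simp
    then have "b - a > 0" using ab by (cases "a = b") auto
    \<comment> \<open>With this slope the permitted rise over \<open>{a..b}\<close> is half of the
      rise assumed for contradiction.\<close>
    define e where "e = (F b - F a) / (2 * (b - a))"
    have eq: "e * (b - a) = (F b - F a) / 2"
      using \<open>b - a > 0\<close> unfolding e_def by (simp add: divide_simps)
    have "e > 0" using lt \<open>b - a > 0\<close> by (simp add: e_def)
    from *[OF this] have "F b \<le> F a + (F b - F a) / 2" unfolding eq .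
    then show False using lt by (simp add: field_simps)
  qed
qed

lemma right_vector_derivative_imp_Dini:
  fixes q :: "real \<Rightarrow> real"
  assumes der: "(q has_vector_derivative d) (at x within {x..})" and "d \<le> 0" "e > 0"
  shows "\<forall>\<^sub>F y in at_right x. q y \<le> q x + e * (y - x)"
proof -
  have "((\<lambda>y. (q y - q x) / (y - x)) \<longlongrightarrow> d) (at x within {x..})"
    using der by (simp add: has_field_derivative_iff flip: has_real_derivative_iff_has_vector_derivative)
  then have "((\<lambda>y. (q y - q x) / (y - x)) \<longlongrightarrow> d) (at_right x)"
    by (rule tendsto_within_subset) auto
  then have "\<forall>\<^sub>F y in at_right x. (q y - q x) / (y - x) < e"
    by (rule order_tendstoD) (use assms in simp)
  moreover have "\<forall>\<^sub>F y in at_right x. x < y" by (simp add: eventually_at_right_less)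
  ultimately show ?thesis
    by eventually_elim (simp add: field_simps)
qed

text \<open>The flows below are differentiable only from the right, so the Dini criterion takes the
  place of the mean value theorem.\<close>

lemma right_vector_derivative_nonpos_imp_le:
  fixes q :: "real \<Rightarrow> real"
  assumes ab: "a \<le> b" and cont: "continuous_on {a..b} q"
    and der: "\<And>x. a \<le> x \<Longrightarrow> x < b \<Longrightarrow> \<exists>d\<le>0. (q has_vector_derivative d) (at x within {x..})"
  shows "q b \<le> q a"
proof (rule lower_Dini_imp_le[OF ab])
  fix x c assume "x \<in> {a..b}" "c < q x"
  then show "\<forall>\<^sub>F y in at x within {a..b}. c < q y"
    using cont by (intro order_tendstoD) (auto simp: continuous_on_def)
next
  fix x e :: real assume x: "a \<le> x" "x < b" "e > 0"
  then obtain d where "d \<le> 0" "(q has_vector_derivative d) (at x within {x..})"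
    using der by blast
  then have "\<forall>\<^sub>F y in at_right x. q y \<le> q x + e * (y - x)"
    using right_vector_derivative_imp_Dini x by blast
  moreover have "\<forall>\<^sub>F y in at_right x. y \<in> {x<..<b}"
    using x by (intro eventually_at_right_real)
  ultimately have "\<forall>\<^sub>F y in at_right x. y \<in> {x<..<b} \<and> q y \<le> q x + e * (y - x)"
    by eventually_elim simp
  then show "\<exists>y\<in>{x<..b}. q y \<le> q x + e * (y - x)"
    by (force dest: eventually_happens)
qed

section \<open>The rescaled flow and its variational inequality\<close>

text \<open>The functional G of the overview. It is meaningful only where \<open>J\<close> is
  finite, because \<open>real_of_ereal\<close> sends infinity to 0.\<close>

definition rescaled_energy :: "('a::real_inner \<Rightarrow> ereal) \<Rightarrow> real \<Rightarrow> 'a \<Rightarrow> real" where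
  "rescaled_energy J l x = real_of_ereal (J x) - l / 2 * (norm x)\<^sup>2"

text \<open>The right derivative is demanded at \<open>s0\<close> too, so \<open>s0\<close> must
  correspond to a positive time of the original flow.\<close>

definition rescaled_flow :: "('a::real_inner \<Rightarrow> ereal) \<Rightarrow> real \<Rightarrow> (real \<Rightarrow> 'a) \<Rightarrow> real \<Rightarrow> bool" where
  "rescaled_flow J l W s0 \<longleftrightarrow> continuous_on {s0..} W \<and>
     (\<forall>s\<ge>s0. \<exists>\<eta>\<in>subdiff J (W s). (W has_vector_derivative l *\<^sub>R W s - \<eta>) (at s within {s..}))"

lemma norm_sq_diff_has_vector_derivative:
  fixes W :: "real \<Rightarrow> 'a::real_inner"
  assumes "(W has_vector_derivative d) (at s within S)"
  shows "((\<lambda>s. (norm (W s - v))\<^sup>2) has_vector_derivative 2 * (d \<bullet> (W s - v))) (at s within S)"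
proof -
  have "((\<lambda>s. W s - v) has_vector_derivative d) (at s within S)"
    using has_vector_derivative_diff[OF assms has_vector_derivative_const[of v]] by simp
  from bounded_bilinear.has_vector_derivative[OF bounded_bilinear_inner this this]
  show ?thesis by (simp add: power2_norm_eq_inner inner_commute)
qed

lemma subdiff_finite:
  assumes "\<zeta> \<in> subdiff J u" "J v < \<infinity>" "J u \<noteq> -\<infinity>"
  shows "\<bar>J u\<bar> \<noteq> \<infinity>"
proof -
  have "J u + ereal (\<zeta> \<bullet> (v - u)) \<le> J v" using assms by (auto simp: subdiff_def)
  then show ?thesis using assms by (cases "J u") auto
qed

lemma subdiffD_real:
  assumes "\<zeta> \<in> subdiff J u" "\<bar>J u\<bar> \<noteq> \<infinity>" "\<bar>J v\<bar> \<noteq> \<infinity>"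
  shows "real_of_ereal (J u) + \<zeta> \<bullet> (v - u) \<le> real_of_ereal (J v)"
proof -
  have "J u + ereal (\<zeta> \<bullet> (v - u)) \<le> J v" using assms by (auto simp: subdiff_def)
  then show ?thesis using assms by (cases "J u"; cases "J v") auto
qed

text \<open>Polarization of \<open>w \<bullet> (w - v)\<close> turns the \<open>l\<close> term into
  the quadratic parts of the energies plus the squared distance; the subgradient inequality at
  \<open>v\<close> bounds the rest. Along the flow the left side is half the derivative of the
  squared distance to \<open>v\<close>.\<close>

lemma evolution_variational_inequality:
  assumes "\<eta> \<in> subdiff J w" "\<bar>J w\<bar> \<noteq> \<infinity>" "\<bar>J v\<bar> \<noteq> \<infinity>"
  shows "(l *\<^sub>R w - \<eta>) \<bullet> (w - v) \<le> rescaled_energy J l v - rescaled_energy J l w + l / 2 * (norm (w - v))\<^sup>2"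
proof -
  have "w \<bullet> (w - v) = (norm w)\<^sup>2 / 2 - (norm v)\<^sup>2 / 2 + (norm (w - v))\<^sup>2 / 2"
    by (simp add: power2_norm_eq_inner inner_diff_left inner_diff_right inner_commute[of v w] field_simps)
  then have "l * (w \<bullet> (w - v)) = l * ((norm w)\<^sup>2 / 2 - (norm v)\<^sup>2 / 2 + (norm (w - v))\<^sup>2 / 2)"
    by (rule arg_cong)
  also have "\<dots> = l / 2 * (norm w)\<^sup>2 - l / 2 * (norm v)\<^sup>2 + l / 2 * (norm (w - v))\<^sup>2"
    by (simp add: distrib_left right_diff_distrib)
  finally have "l * (w \<bullet> (w - v)) = \<dots>" .
  moreover have "(l *\<^sub>R w - \<eta>) \<bullet> (w - v) = l * (w \<bullet> (w - v)) + \<eta> \<bullet> (v - w)"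
    by (simp add: inner_diff_left inner_diff_right right_diff_distrib)
  ultimately show ?thesis
    using subdiffD_real[OF assms] unfolding rescaled_energy_def by linarith
qed

section \<open>Gronwall estimate, energy decay and limits of the rescaled flow\<close>

locale nonneg_lsc_zero =
  fixes J :: "'a::real_inner \<Rightarrow> ereal"
  assumes lsc: "lsc_fun J" and nonneg: "J u \<ge> 0" and zero: "J 0 = 0"
begin

lemma finite_subdiff:
  assumes "\<zeta> \<in> subdiff J u"
  shows "\<bar>J u\<bar> \<noteq> \<infinity>"
proof (rule subdiff_finite[OF assms])
  show "J 0 < \<infinity>" by (simp add: zero)
  show "J u \<noteq> -\<infinity>" using nonneg[of u] by (cases "J u") simp_all
qed

lemma finite_flow:
  assumes "rescaled_flow J l W s0" "s0 \<le> s"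
  shows "\<bar>J (W s)\<bar> \<noteq> \<infinity>"
proof -
  obtain \<eta> where "\<eta> \<in> subdiff J (W s)"
    using assms unfolding rescaled_flow_def by blast
  then show ?thesis by (rule finite_subdiff)
qed

text \<open>Replacing the energy of \<open>W r\<close> by its lower bound \<open>g\<close> in the
  variational inequality shows that the derivative of
  \<open>l / 2 * (norm (W r - v))\<^sup>2 + C\<close> is at most \<open>l\<close> times this
  expression, so its product with \<open>exp (- l * r)\<close> cannot increase. The constant
  \<open>C\<close> may be negative.\<close>

lemma rescaled_flow_gronwall:
  assumes flow: "rescaled_flow J l W s0" and l: "l > 0" and ord: "s0 \<le> s" "s \<le> t"
    and v: "\<bar>J v\<bar> \<noteq> \<infinity>"
    and g: "\<And>r. s \<le> r \<Longrightarrow> r < t \<Longrightarrow> g \<le> rescaled_energy J l (W r)"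
  shows "l / 2 * (norm (W t - v))\<^sup>2 + (rescaled_energy J l v - g)
      \<le> exp (l * (t - s)) * (l / 2 * (norm (W s - v))\<^sup>2 + (rescaled_energy J l v - g))"
proof -
  define C where "C = rescaled_energy J l v - g"
  define E where "E r = exp (- l * r) * (l / 2 * (norm (W r - v))\<^sup>2 + C)" for r
  have "E t \<le> E s"
  proof (rule right_vector_derivative_nonpos_imp_le[OF ord(2)])
    have "continuous_on {s..t} W"
      using flow ord unfolding rescaled_flow_def
      by (auto intro: continuous_on_subset)
    then show "continuous_on {s..t} E"
      unfolding E_def by (intro continuous_intros)
  next
    fix r assume r: "s \<le> r" "r < t"
    then obtain \<eta> where \<eta>: "\<eta> \<in> subdiff J (W r)"
      and der: "(W has_vector_derivative l *\<^sub>R W r - \<eta>) (at r within {r..})"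
      using flow ord unfolding rescaled_flow_def by (meson order_trans)
    have dexp: "((\<lambda>r. exp (- l * r)) has_vector_derivative - l * exp (- l * r)) (at r within {r..})"
      unfolding has_real_derivative_iff_has_vector_derivative[symmetric]
      by (auto intro!: derivative_eq_intros)
    have dn: "((\<lambda>r. l / 2 * (norm (W r - v))\<^sup>2 + C) has_vector_derivative
        l * ((l *\<^sub>R W r - \<eta>) \<bullet> (W r - v))) (at r within {r..})"
      using has_vector_derivative_add[OF bounded_linear.has_vector_derivative[OF bounded_linear_mult_right
          [of "l / 2"] norm_sq_diff_has_vector_derivative[OF der, of v]] has_vector_derivative_const[of C]]
      by simp
    have "(E has_vector_derivative exp (- l * r) * (l * ((l *\<^sub>R W r - \<eta>) \<bullet> (W r - v)))
        + - l * exp (- l * r) * (l / 2 * (norm (W r - v))\<^sup>2 + C)) (at r within {r..})"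
      unfolding E_def
      by (rule bounded_bilinear.has_vector_derivative[OF bounded_bilinear_mult dexp dn])
    moreover have "exp (- l * r) * (l * ((l *\<^sub>R W r - \<eta>) \<bullet> (W r - v)))
        + - l * exp (- l * r) * (l / 2 * (norm (W r - v))\<^sup>2 + C)
        = (l * exp (- l * r)) * (((l *\<^sub>R W r - \<eta>) \<bullet> (W r - v)) - (l / 2 * (norm (W r - v))\<^sup>2 + C))"
      by (simp add: algebra_simps)
    moreover have "(l *\<^sub>R W r - \<eta>) \<bullet> (W r - v) \<le> l / 2 * (norm (W r - v))\<^sup>2 + C"
      using evolution_variational_inequality[OF \<eta> finite_subdiff[OF \<eta>] v, of l] g[OF r]
      unfolding C_def by linarith
    moreover have "l * exp (- l * r) \<ge> 0" using l by simp
    ultimately show "\<exists>d\<le>0. (E has_vector_derivative d) (at r within {r..})"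
      by (intro exI[of _ "l * exp (- l * r) *
          (((l *\<^sub>R W r - \<eta>) \<bullet> (W r - v)) - (l / 2 * (norm (W r - v))\<^sup>2 + C))"])
        (simp only: mult_nonneg_nonpos diff_le_0_iff_le simp_thms)
  qed
  then have "exp (l * t) * E t \<le> exp (l * t) * E s" by simp
  moreover have "exp (l * t) * E r = exp (l * (t - r)) * (l / 2 * (norm (W r - v))\<^sup>2 + C)" for r
  proof -
    have "exp (l * t) * exp (- l * r) = exp (l * (t - r))"
      by (simp add: right_diff_distrib flip: exp_add)
    then show ?thesis by (simp add: E_def flip: mult.assoc)
  qed
  ultimately show ?thesis by (simp add: C_def)
qed

text \<open>If the energy stayed above its initial value (up to a quadratic term) on a right neighbourhood
  of \<open>x\<close>, the variational inequality with \<open>v = W x\<close> would make \<open>W\<close> constant there. Hence the lower right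
  Dini derivative of the energy is nonpositive, and no chain rule for \<open>J\<close> is required.\<close>

lemma rescaled_energy_antimono:
  assumes flow: "rescaled_flow J l W s0" and l: "l > 0" and ord: "s0 \<le> s" "s \<le> t"
  shows "rescaled_energy J l (W t) \<le> rescaled_energy J l (W s)"
proof -
  define G where "G r = rescaled_energy J l (W r)" for r
  have fin: "\<bar>J (W r)\<bar> \<noteq> \<infinity>" if "s0 \<le> r" for r
    using finite_flow[OF flow that] .
  have cont: "continuous_on {s..t} W"
    using flow ord unfolding rescaled_flow_def by (auto intro: continuous_on_subset)
  have "G t \<le> G s"
  proof (rule lower_Dini_imp_le[OF ord(2)])
    fix x c assume x: "x \<in> {s..t}" and c: "c < G x"
    \<comment> \<open>One half of the margin absorbs a drop of \<open>J\<close>, the other a rise of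
      the quadratic term.\<close>
    define e where "e = (G x - c) / 2"
    have e: "e > 0" using c by (simp add: e_def)
    have Wx: "(W \<longlongrightarrow> W x) (at x within {s..t})"
      using cont x by (simp add: continuous_on_def)
    have "ereal (real_of_ereal (J (W x)) - e) < J (W x)"
      using fin[of x] x ord e by (cases "J (W x)") auto
    then have "\<forall>\<^sub>F y in at (W x). ereal (real_of_ereal (J (W x)) - e) < J y"
      using lsc unfolding lsc_fun_def by blast
    \<comment> \<open>\<open>W y\<close> may equal \<open>W x\<close> for \<open>y\<close> near
      \<open>x\<close>, so the punctured filter of \<open>lsc_fun\<close> is first completed by the
      point itself.\<close>
    then have "\<forall>\<^sub>F y in nhds (W x). ereal (real_of_ereal (J (W x)) - e) < J y"
      using \<open>ereal _ < J (W x)\<close> by (auto simp: eventually_nhds_conv_at)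
    then have 1: "\<forall>\<^sub>F y in at x within {s..t}. ereal (real_of_ereal (J (W x)) - e) < J (W y)"
      using Wx filterlim_iff by blast
    have "((\<lambda>y. l / 2 * (norm (W y))\<^sup>2) \<longlongrightarrow> l / 2 * (norm (W x))\<^sup>2) (at x within {s..t})"
      by (intro tendsto_intros Wx)
    then have 2: "\<forall>\<^sub>F y in at x within {s..t}. l / 2 * (norm (W y))\<^sup>2 < l / 2 * (norm (W x))\<^sup>2 + e"
      using e by (intro order_tendstoD) auto
    have 3: "\<forall>\<^sub>F y in at x within {s..t}. y \<in> {s..t}"
      by (auto simp: eventually_at_filter)
    show "\<forall>\<^sub>F y in at x within {s..t}. c < G y"
      using 1 2 3
    proof eventually_elim
      case (elim y)
      have "real_of_ereal (J (W x)) - e < real_of_ereal (J (W y))"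
        using elim fin[of y] ord by (cases "J (W y)") auto
      then show ?case using elim unfolding G_def rescaled_energy_def e_def by argo
    qed
  next
    fix x e :: real assume x: "s \<le> x" "x < t" and e: "e > 0"
    have s0x: "s0 \<le> x" using x ord by simp
    obtain \<eta> where der: "(W has_vector_derivative l *\<^sub>R W x - \<eta>) (at x within {x..})"
      using flow s0x unfolding rescaled_flow_def by blast
    have "((\<lambda>r. l / 2 * (norm (W r - W x))\<^sup>2) has_vector_derivative 0) (at x within {x..})"
      using bounded_linear.has_vector_derivative[OF bounded_linear_mult_right
          [of "l / 2"] norm_sq_diff_has_vector_derivative[OF der, of "W x"]] by simp
    from right_vector_derivative_imp_Dini[OF this order_refl e]
    have "\<forall>\<^sub>F y in at_right x. l / 2 * (norm (W y - W x))\<^sup>2 \<le> e * (y - x)" by simp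
    moreover have "\<forall>\<^sub>F y in at_right x. y \<in> {x<..<t}"
      using x by (intro eventually_at_right_real)
    ultimately have "\<forall>\<^sub>F y in at_right x. y < t \<and> l / 2 * (norm (W y - W x))\<^sup>2 \<le> e * (y - x)"
      by eventually_elim simp
    then obtain b where b: "b > x"
      and bq: "\<And>y. x < y \<Longrightarrow> y < b \<Longrightarrow> y < t \<and> l / 2 * (norm (W y - W x))\<^sup>2 \<le> e * (y - x)"
      unfolding eventually_at_right_field by blast
    show "\<exists>y\<in>{x<..t}. G y \<le> G x + e * (y - x)"
    proof (rule ccontr)
      assume contra: "\<not> ?thesis"
      have above: "G x \<le> G y" if "x \<le> y" "y < b" for y
      proof (cases "y = x")
        case False
        then have "x < y" using that by simp
        then have "y \<in> {x<..t}" using bq[of y] that by auto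
        then have "\<not> G y \<le> G x + e * (y - x)" using contra by blast
        moreover have "e * (y - x) > 0" using \<open>x < y\<close> e by simp
        ultimately show ?thesis by linarith
      qed simp
      define y where "y = (x + b) / 2"
      have y: "x < y" "y < b" using b by (auto simp: y_def)
      \<comment> \<open>With \<open>v = W x\<close> and \<open>g = G x\<close> the right side of the
        Gronwall estimate is 0. The resulting \<open>G y = G x\<close> makes \<open>y\<close> a
        witness for the bound denied in \<open>contra\<close>.\<close>
      have "l / 2 * (norm (W y - W x))\<^sup>2 + (G x - G x)
        \<le> exp (l * (y - x)) * (l / 2 * (norm (W x - W x))\<^sup>2 + (G x - G x))"
        unfolding G_def
        using y above[unfolded G_def] fin s0x by (intro rescaled_flow_gronwall[OF flow l s0x]) auto
      then have "W y = W x" using l by (simp add: mult_le_0_iff)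
      then have "G y = G x" by (simp add: G_def)
      moreover have "y \<in> {x<..t}" using bq[of y] y by auto
      moreover have "e * (y - x) > 0" using y e by simp
      ultimately show False using contra by (smt (verit))
    qed
  qed
  then show ?thesis by (simp add: G_def)
qed

lemma lsc_le_limit:
  assumes x: "x \<longlonglongrightarrow> z" and fin: "\<forall>\<^sub>F k in sequentially. \<bar>J (x k)\<bar> \<noteq> \<infinity>"
    and lim: "(\<lambda>k. real_of_ereal (J (x k))) \<longlonglongrightarrow> b"
  shows "J z \<le> ereal b"
proof (rule ccontr)
  assume "\<not> J z \<le> ereal b"
  then have "ereal b < J z" by simp
  then obtain c where c: "ereal b < ereal c" "ereal c < J z"
    using ereal_dense2 by blast
  then have "\<forall>\<^sub>F y in nhds z. ereal c < J y"
    using lsc unfolding lsc_fun_def by (auto simp: eventually_nhds_conv_at)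
  then have 1: "\<forall>\<^sub>F k in sequentially. ereal c < J (x k)"
    using x filterlim_iff by blast
  have 2: "\<forall>\<^sub>F k in sequentially. real_of_ereal (J (x k)) < c"
    using lim c by (intro order_tendstoD) auto
  have "\<forall>\<^sub>F k in sequentially. False"
    using 1 2 fin
  proof eventually_elim
    case (elim k)
    then show ?case by (cases "J (x k)") auto
  qed
  then show False by simp
qed

lemma rescaled_flow_limit_eigenvector:
  assumes flow: "rescaled_flow J l W s0" and l: "l > 0"
    and sk: "filterlim sk at_top sequentially"
    and conv: "(\<lambda>k. W (sk k)) \<longlonglongrightarrow> w"
  shows "l *\<^sub>R w \<in> subdiff J w"
proof -
  define G where "G r = rescaled_energy J l (W r)" for r
  have anti: "G t \<le> G s" if "s0 \<le> s" "s \<le> t" for s t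
    using rescaled_energy_antimono[OF flow l that] by (simp add: G_def)
  have ev: "\<forall>\<^sub>F k in sequentially. r \<le> sk k" for r
    using sk by (simp add: filterlim_at_top)
  have fin: "\<bar>J (W r)\<bar> \<noteq> \<infinity>" if "s0 \<le> r" for r
    using finite_flow[OF flow that] .
  have conv2: "(\<lambda>k. l / 2 * (norm (W (sk k)))\<^sup>2) \<longlonglongrightarrow> l / 2 * (norm w)\<^sup>2"
    by (intro tendsto_intros conv)
  \<comment> \<open>Late in the sequence the quadratic term is within 1 of its limit and
    \<open>J\<close> is nonnegative; monotonicity carries the bound back to every
    \<open>r\<close>.\<close>
  have low: "- (l / 2 * (norm w)\<^sup>2 + 1) \<le> G r" if r: "s0 \<le> r" for r
  proof -
    have "\<forall>\<^sub>F k in sequentially. l / 2 * (norm (W (sk k)))\<^sup>2 < l / 2 * (norm w)\<^sup>2 + 1"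
      using conv2 by (intro order_tendstoD) auto
    with ev[of r] have "\<forall>\<^sub>F k in sequentially. r \<le> sk k \<and> l / 2 * (norm (W (sk k)))\<^sup>2 < l / 2 * (norm w)\<^sup>2 + 1"
      by eventually_elim simp
    then obtain k where k: "r \<le> sk k" "l / 2 * (norm (W (sk k)))\<^sup>2 < l / 2 * (norm w)\<^sup>2 + 1"
      using eventually_happens trivial_limit_sequentially by blast
    have "0 \<le> real_of_ereal (J (W (sk k)))" using nonneg by (simp add: real_of_ereal_pos)
    then have "- (l / 2 * (norm w)\<^sup>2 + 1) \<le> G (sk k)"
      using k unfolding G_def rescaled_energy_def by linarith
    then show ?thesis using anti[OF r k(1)] by linarith
  qed
  define g where "g = Inf (G ` {s0..})"
  have bdd: "bdd_below (G ` {s0..})" using low by (intro bdd_belowI2) auto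
  have gle: "g \<le> G r" if "s0 \<le> r" for r
    unfolding g_def using that by (intro cInf_lower bdd) auto
  \<comment> \<open>Windows of length 1 have the fixed growth factor \<open>exp l > 1\<close>, which
    survives the passage to the limit.\<close>
  have gron: "l / 2 * (norm (W (r + 1) - v))\<^sup>2 + (rescaled_energy J l v - g)
      \<le> exp l * (l / 2 * (norm (W r - v))\<^sup>2 + (rescaled_energy J l v - g))"
    if r: "s0 \<le> r" and v: "\<bar>J v\<bar> \<noteq> \<infinity>" for r v
  proof -
    have "g \<le> rescaled_energy J l (W x)" if "r \<le> x" for x
      using gle[of x] that r by (simp add: G_def)
    then show ?thesis
      using rescaled_flow_gronwall[OF flow l r _ v, of "r + 1" g] by simp
  qed
  have Glim: "(\<lambda>k. G (sk k)) \<longlonglongrightarrow> g"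
  proof (rule order_tendstoI)
    fix c assume "c < g"
    show "\<forall>\<^sub>F k in sequentially. c < G (sk k)"
      using ev[of s0] by eventually_elim (use \<open>c < g\<close> gle in force)
  next
    fix c assume "g < c"
    then obtain r where r: "s0 \<le> r" "G r < c"
      using cInf_less_iff[of "G ` {s0..}" c] bdd unfolding g_def by auto
    show "\<forall>\<^sub>F k in sequentially. G (sk k) < c"
      using ev[of r] by eventually_elim (use anti r in force)
  qed
  \<comment> \<open>With \<open>v = W (sk k)\<close> the initial distance vanishes, and the
    displacement over the window is controlled by \<open>G (sk k) - g\<close>.\<close>
  have "(\<lambda>k. W (sk k + 1) - W (sk k)) \<longlonglongrightarrow> 0"
  proof -
    have up: "\<forall>\<^sub>F k in sequentially. (norm (W (sk k + 1) - W (sk k)))\<^sup>2 \<le> 2 / l * exp l * (G (sk k) - g)"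
      using ev[of s0]
    proof eventually_elim
      case (elim k)
      have "l / 2 * (norm (W (sk k + 1) - W (sk k)))\<^sup>2 + (G (sk k) - g) \<le> exp l * (G (sk k) - g)"
        using gron[OF elim fin[OF elim]] by (simp add: G_def)
      then have "l / 2 * (norm (W (sk k + 1) - W (sk k)))\<^sup>2 \<le> exp l * (G (sk k) - g)"
        using gle[OF elim] by linarith
      then have "2 / l * (l / 2 * (norm (W (sk k + 1) - W (sk k)))\<^sup>2) \<le> 2 / l * (exp l * (G (sk k) - g))"
        using l by (intro mult_left_mono) auto
      then show ?case using l by simp
    qed
    have "(\<lambda>k. 2 / l * exp l * (G (sk k) - g)) \<longlonglongrightarrow> 2 / l * exp l * (g - g)"
      by (intro tendsto_mult tendsto_diff tendsto_const Glim)
    then have lim0: "(\<lambda>k. 2 / l * exp l * (G (sk k) - g)) \<longlonglongrightarrow> 0"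
      by (simp only: diff_self mult_zero_right)
    have "(\<lambda>k. (norm (W (sk k + 1) - W (sk k)))\<^sup>2) \<longlonglongrightarrow> 0"
      by (rule tendsto_sandwich[OF _ up tendsto_const lim0]) simp
    then have "(\<lambda>k. sqrt ((norm (W (sk k + 1) - W (sk k)))\<^sup>2)) \<longlonglongrightarrow> sqrt 0"
      by (rule tendsto_real_sqrt)
    then have "(\<lambda>k. norm (W (sk k + 1) - W (sk k))) \<longlonglongrightarrow> 0"
      by (simp only: real_sqrt_abs abs_norm_cancel real_sqrt_zero)
    then show ?thesis by (rule tendsto_norm_zero_cancel)
  qed
  from tendsto_add[OF this conv] have conv': "(\<lambda>k. W (sk k + 1)) \<longlonglongrightarrow> w" by simp
  have "(\<lambda>k. G (sk k) + l / 2 * (norm (W (sk k)))\<^sup>2) \<longlonglongrightarrow> g + l / 2 * (norm w)\<^sup>2"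
    by (intro tendsto_add Glim conv2)
  then have "(\<lambda>k. real_of_ereal (J (W (sk k)))) \<longlonglongrightarrow> g + l / 2 * (norm w)\<^sup>2"
    by (simp add: G_def rescaled_energy_def)
  moreover have "\<forall>\<^sub>F k in sequentially. \<bar>J (W (sk k))\<bar> \<noteq> \<infinity>"
    using ev[of s0] by eventually_elim (rule fin)
  ultimately have Jw: "J w \<le> ereal (g + l / 2 * (norm w)\<^sup>2)"
    using lsc_le_limit[OF conv] by blast
  show ?thesis
    unfolding subdiff_def
  proof safe
    fix v
    show "J w + ereal ((l *\<^sub>R w) \<bullet> (v - w)) \<le> J v"
    proof (cases "J v = \<infinity>")
      case False
      then have Jv: "\<bar>J v\<bar> \<noteq> \<infinity>" using nonneg[of v] by auto
      define C where "C = rescaled_energy J l v - g"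
      have "(\<lambda>k. l / 2 * (norm (W (sk k + 1) - v))\<^sup>2 + C) \<longlonglongrightarrow> l / 2 * (norm (w - v))\<^sup>2 + C"
        by (intro tendsto_intros conv')
      moreover have "(\<lambda>k. exp l * (l / 2 * (norm (W (sk k) - v))\<^sup>2 + C)) \<longlonglongrightarrow>
          exp l * (l / 2 * (norm (w - v))\<^sup>2 + C)"
        by (intro tendsto_intros conv)
      moreover have "\<forall>\<^sub>F k in sequentially. l / 2 * (norm (W (sk k + 1) - v))\<^sup>2 + C
          \<le> exp l * (l / 2 * (norm (W (sk k) - v))\<^sup>2 + C)"
        using ev[of s0]
      proof eventually_elim
        case (elim k)
        show ?case unfolding C_def by (rule gron[OF elim Jv])
      qed
      \<comment> \<open>The limit of the Gronwall estimate bounds a number by \<open>exp l\<close>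
        times itself, so that number is nonnegative.\<close>
      ultimately have "l / 2 * (norm (w - v))\<^sup>2 + C \<le> exp l * (l / 2 * (norm (w - v))\<^sup>2 + C)"
        by (intro tendsto_le[OF trivial_limit_sequentially])
      then have "0 \<le> (exp l - 1) * (l / 2 * (norm (w - v))\<^sup>2 + C)"
        by (simp only: left_diff_distrib mult_1 diff_ge_0_iff_ge)
      moreover have "exp l - 1 > 0" using l by simp
      ultimately have "0 \<le> l / 2 * (norm (w - v))\<^sup>2 + C" by (simp add: zero_le_mult_iff)
      \<comment> \<open>Polarization again: the squared distance splits into the quadratic parts,
        which cancel against \<open>C\<close> and \<open>Jw\<close>, and the linear term of the
        subgradient inequality.\<close>
      moreover have "l / 2 * (norm (w - v))\<^sup>2 = l / 2 * (norm v)\<^sup>2 - l / 2 * (norm w)\<^sup>2 - l * (w \<bullet> (v - w))"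
        by (simp add: power2_norm_eq_inner inner_diff inner_commute field_simps)
      ultimately have "g + l / 2 * (norm w)\<^sup>2 + l * (w \<bullet> (v - w)) \<le> real_of_ereal (J v)"
        unfolding C_def rescaled_energy_def by linarith
      then show ?thesis using Jw Jv nonneg[of w] by (cases "J w"; cases "J v") auto
    qed simp
  qed
qed

end

section \<open>Consequences of convexity and homogeneity\<close>

lemma convex_fun_midpoint:
  assumes "convex_fun J"
  shows "J ((1/2) *\<^sub>R x + (1/2) *\<^sub>R y) \<le> ereal (1/2) * J x + ereal (1/2) * J y"
  using assms[unfolded convex_fun_def, THEN spec[of _ x], THEN spec[of _ y], THEN spec[of _ "1/2"]]
  by simp

text \<open>0 is the midpoint of \<open>u\<close> and \<open>- u\<close>, at which \<open>J\<close>
  takes equal values.\<close>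

lemma abs_homogeneous_nonneg:
  assumes conv: "convex_fun J" and hom: "abs_homogeneous p J"
  shows "0 \<le> J u"
proof -
  have "J ((1/2) *\<^sub>R u + (1/2) *\<^sub>R (- u)) \<le> ereal (1/2) * J u + ereal (1/2) * J (- u)"
    using conv by (rule convex_fun_midpoint)
  moreover have "J (- u) = J u"
    using hom unfolding abs_homogeneous_def
    by (metis (no_types) abs_minus_cancel abs_one mult_1 one_ereal_def powr_one_eq_one scaleR_minus_left scaleR_one zero_neq_neg_one)
  moreover have "J 0 = 0" using hom by (simp add: abs_homogeneous_def)
  ultimately show ?thesis by (cases "J u") auto
qed

text \<open>The subgradient inequality is tested at \<open>v /\<^sub>R c\<close> and multiplied by
  \<open>c powr p\<close>; one factor \<open>c\<close> goes into the second argument of the inner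
  product, leaving degree \<open>p - 1\<close>.\<close>

lemma homogeneous_subdiff:
  assumes hom: "abs_homogeneous p J" and c: "c > 0" and \<zeta>: "\<zeta> \<in> subdiff J u"
  shows "(c powr (p - 1)) *\<^sub>R \<zeta> \<in> subdiff J (c *\<^sub>R u)"
  unfolding subdiff_def
proof safe
  fix v
  have sc: "J (c *\<^sub>R x) = ereal (c powr p) * J x" for x
    using hom c unfolding abs_homogeneous_def by auto
  have "J u + ereal (\<zeta> \<bullet> (v /\<^sub>R c - u)) \<le> J (v /\<^sub>R c)"
    using \<zeta> by (auto simp: subdiff_def)
  then have "ereal (c powr p) * (J u + ereal (\<zeta> \<bullet> (v /\<^sub>R c - u))) \<le> ereal (c powr p) * J (v /\<^sub>R c)"
    by (intro ereal_mult_left_mono) auto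
  moreover have "J (c *\<^sub>R (v /\<^sub>R c)) = J v" using c by simp
  ultimately have le: "ereal (c powr p) * (J u + ereal (\<zeta> \<bullet> (v /\<^sub>R c - u))) \<le> J v"
    by (simp only: sc)
  have "c powr p * (\<zeta> \<bullet> (v /\<^sub>R c - u)) = (c powr (p - 1) *\<^sub>R \<zeta>) \<bullet> (v - c *\<^sub>R u)"
    using c by (simp add: powr_diff inner_diff field_simps)
  then have "ereal (c powr p) * (J u + ereal (\<zeta> \<bullet> (v /\<^sub>R c - u)))
      = J (c *\<^sub>R u) + ereal ((c powr (p - 1) *\<^sub>R \<zeta>) \<bullet> (v - c *\<^sub>R u))"
    using c by (cases "J u") (auto simp: sc algebra_simps)
  with le show "J (c *\<^sub>R u) + ereal ((c powr (p - 1) *\<^sub>R \<zeta>) \<bullet> (v - c *\<^sub>R u)) \<le> J v" by simp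
qed

text \<open>Since \<open>u + c *\<^sub>R n\<close> is the midpoint of \<open>2 *\<^sub>R u\<close>
  and \<open>(2 * c) *\<^sub>R n\<close>, its energy is bounded uniformly in \<open>c\<close>,
  whereas the subgradient bound from below is affine in \<open>c\<close> with slope
  \<open>\<zeta> \<bullet> n\<close>.\<close>

lemma subdiff_orthogonal_null:
  assumes conv: "convex_fun J" and hom: "abs_homogeneous p J"
    and \<zeta>: "\<zeta> \<in> subdiff J u" and fin: "\<bar>J u\<bar> \<noteq> \<infinity>" and n: "n \<in> null_set J"
  shows "\<zeta> \<bullet> n = 0"
proof (rule ccontr)
  assume nz: "\<zeta> \<bullet> n \<noteq> 0"
  define j where "j = real_of_ereal (J u)"
  have j: "J u = ereal j" using fin by (simp add: j_def ereal_real)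
  define K where "K = 2 powr p / 2 * j"
  have bound: "j + c * (\<zeta> \<bullet> n) \<le> K" for c
  proof -
    have cn: "J ((2 * c) *\<^sub>R n) = 0"
      using hom n unfolding abs_homogeneous_def null_set_def by (cases "c = 0") auto
    have 2: "J (2 *\<^sub>R u) = ereal (2 powr p * j)"
      using hom j unfolding abs_homogeneous_def by simp
    have "J ((1/2) *\<^sub>R (2 *\<^sub>R u) + (1/2) *\<^sub>R ((2 * c) *\<^sub>R n))
        \<le> ereal (1/2) * J (2 *\<^sub>R u) + ereal (1/2) * J ((2 * c) *\<^sub>R n)"
      using conv by (rule convex_fun_midpoint)
    then have "J (u + c *\<^sub>R n) \<le> ereal K" using cn 2 by (simp add: K_def)
    moreover have "J u + ereal (\<zeta> \<bullet> (u + c *\<^sub>R n - u)) \<le> J (u + c *\<^sub>R n)"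
      using \<zeta> unfolding subdiff_def by blast
    ultimately have "J u + ereal (\<zeta> \<bullet> (u + c *\<^sub>R n - u)) \<le> ereal K" by (rule order_trans[rotated])
    then show ?thesis by (simp add: j)
  qed
  \<comment> \<open>For this \<open>c\<close> the left side of \<open>bound\<close> equals
    \<open>K + 1\<close>.\<close>
  from bound[of "(K - j + 1) / (\<zeta> \<bullet> n)"] nz show False by simp
qed

section \<open>Logarithmic time and decay rate\<close>

text \<open>\<open>rescaled_time p l\<close> is the original time as a function of the logarithmic time
  \<open>s = - ln (decay_rate p l t) / l\<close>.\<close>

definition rescaled_time :: "real \<Rightarrow> real \<Rightarrow> real \<Rightarrow> real" where
  "rescaled_time p l s = (if p > 2 then (exp ((p - 2) * l * s) - 1) / ((p - 2) * l) else s)"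

text \<open>The function \<open>a\<close> of the theorem with its rate as a parameter, because the
  lower bound on the norm compares two rates.\<close>

definition decay_rate :: "real \<Rightarrow> real \<Rightarrow> real \<Rightarrow> real" where
  "decay_rate p l t = (if p > 2 then (1 + (p - 2) * l * t) powr (- 1 / (p - 2)) else exp (- l * t))"

lemma rescaled_time_0 [simp]: "rescaled_time p l 0 = 0"
  by (simp add: rescaled_time_def)

lemma rescaled_time_less_iff:
  assumes "l > 0"
  shows "rescaled_time p l s < rescaled_time p l t \<longleftrightarrow> s < t"
proof (cases "p > 2")
  case True
  then have "(p - 2) * l > 0" using assms by simp
  then have "\<not> (p - 2) * l < 0" by simp
  with True assms show ?thesis by (simp add: rescaled_time_def divide_less_cancel)
qed (simp add: rescaled_time_def)

lemma rescaled_time_le_iff: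
  assumes "l > 0"
  shows "rescaled_time p l s \<le> rescaled_time p l t \<longleftrightarrow> s \<le> t"
  using rescaled_time_less_iff[OF assms, of p t s] by (simp add: not_less[symmetric])

text \<open>With \<open>a = exp (- l * s)\<close>, the equation for \<open>a\<close> says that s has
  derivative \<open>a powr (p - 2)\<close> in t; this is the reciprocal.\<close>

lemma rescaled_time_has_real_derivative:
  assumes "l > 0" "p \<ge> 2"
  shows "(rescaled_time p l has_real_derivative exp ((p - 2) * l * s)) (at s within S)"
proof (cases "p > 2")
  case True
  have "((\<lambda>s. (exp ((p - 2) * l * s) - 1) / ((p - 2) * l)) has_real_derivative exp ((p - 2) * l * s))
      (at s within S)"
    using assms True by (auto intro!: derivative_eq_intros)
  then show ?thesis using True by (simp add: rescaled_time_def[abs_def])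
next
  case False
  then show ?thesis using assms by (simp add: rescaled_time_def[abs_def])
qed

lemma decay_rate_pos: "p \<ge> 2 \<Longrightarrow> l > 0 \<Longrightarrow> t \<ge> 0 \<Longrightarrow> decay_rate p l t > 0"
  using add_pos_nonneg[of 1 "(p - 2) * l * t"] by (simp add: decay_rate_def)

lemma rescaled_time_decay_rate:
  assumes "p \<ge> 2" "l > 0" "t \<ge> 0"
  shows "rescaled_time p l (- ln (decay_rate p l t) / l) = t"
proof (cases "p > 2")
  case True
  define x where "x = 1 + (p - 2) * l * t"
  have x: "x > 0" using assms True by (simp add: x_def add_pos_nonneg)
  have "ln (decay_rate p l t) = - (ln x / (p - 2))"
    using True x by (simp add: decay_rate_def ln_powr flip: x_def)
  moreover have "(p - 2) * l * (- ln (decay_rate p l t) / l) = (p - 2) * - ln (decay_rate p l t)"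
    using assms by simp
  ultimately have "(p - 2) * l * (- ln (decay_rate p l t) / l) = ln x"
    using True by simp
  then have "rescaled_time p l (- ln (decay_rate p l t) / l) = (x - 1) / ((p - 2) * l)"
    using True x by (simp only: rescaled_time_def if_True exp_ln)
  then show ?thesis using True assms by (simp add: x_def)
next
  case False
  then show ?thesis using assms by (simp add: rescaled_time_def decay_rate_def)
qed

lemma exp_decay_rate:
  assumes "p \<ge> 2" "l > 0" "t \<ge> 0"
  shows "exp (l * (- ln (decay_rate p l t) / l)) = 1 / decay_rate p l t"
  using assms decay_rate_pos[OF assms] by (simp add: exp_minus inverse_eq_divide)

section \<open>The gradient flow in rescaled variables\<close>

text \<open>The change of time contributes \<open>exp ((p - 2) * l * s)\<close> to the velocity and
  the scaling of space \<open>exp (l * s)\<close>; their product is exactly the factor by which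
  subgradients scale. The condition \<open>pos\<close> avoids time 0, where \<open>grad_flow\<close>
  provides no right derivative.\<close>

lemma rescaled_flow_of_grad_flow:
  assumes flow: "grad_flow J f u" and hom: "abs_homogeneous p J" and p: "p \<ge> 2" and l: "l > 0"
    and d: "d \<ge> 0" and s0: "s0 \<ge> 0" and pos: "d > 0 \<or> s0 > 0"
  shows "rescaled_flow J l (\<lambda>s. exp (l * s) *\<^sub>R u (d + rescaled_time p l s)) s0"
  unfolding rescaled_flow_def
proof (intro conjI allI impI)
  have ge: "d + rescaled_time p l s \<ge> 0" if "s \<ge> s0" for s
    using rescaled_time_le_iff[OF l, of p 0 s] that s0 d by simp
  have cu: "continuous_on {0..} u" using flow by (simp add: grad_flow_def)
  have "continuous_on {s0..} (rescaled_time p l)"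
    using rescaled_time_has_real_derivative[OF l p] by (intro DERIV_continuous_on)
  then have "continuous_on {s0..} (\<lambda>s. u (d + rescaled_time p l s))"
    using ge by (intro continuous_on_compose2[OF cu] continuous_intros) auto
  then show "continuous_on {s0..} (\<lambda>s. exp (l * s) *\<^sub>R u (d + rescaled_time p l s))"
    by (intro continuous_intros)
next
  fix s assume s: "s0 \<le> s"
  define T where "T r = d + rescaled_time p l r" for r
  have "T s > 0"
    using rescaled_time_le_iff[OF l, of p 0 s] rescaled_time_less_iff[OF l, of p 0 s] s s0 d pos
    unfolding T_def by fastforce
  then obtain z where z: "z \<in> subdiff J (u (T s))"
    and du: "(u has_vector_derivative - z) (at (T s) within {T s..})"
    using flow unfolding grad_flow_def min_norm_elem_def by blast
  have "(T has_vector_derivative exp ((p - 2) * l * s)) (at s within {s..})"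
    unfolding T_def has_real_derivative_iff_has_vector_derivative[symmetric]
    using DERIV_add[OF DERIV_const[of d] rescaled_time_has_real_derivative[OF l p]] by simp
  moreover have "T ` {s..} \<subseteq> {T s..}"
    using rescaled_time_le_iff[OF l] by (auto simp: T_def)
  ultimately have "((u \<circ> T) has_vector_derivative exp ((p - 2) * l * s) *\<^sub>R (- z)) (at s within {s..})"
    using du by (intro vector_diff_chain_within) (auto intro: has_vector_derivative_within_subset)
  moreover have "((\<lambda>s. exp (l * s)) has_vector_derivative l * exp (l * s)) (at s within {s..})"
    unfolding has_real_derivative_iff_has_vector_derivative[symmetric]
    by (auto intro!: derivative_eq_intros)
  ultimately have "((\<lambda>s. exp (l * s) *\<^sub>R (u \<circ> T) s) has_vector_derivative
      exp (l * s) *\<^sub>R (exp ((p - 2) * l * s) *\<^sub>R (- z)) + (l * exp (l * s)) *\<^sub>R (u \<circ> T) s)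
      (at s within {s..})"
    by (intro bounded_bilinear.has_vector_derivative[OF bounded_bilinear_scaleR])
  moreover have "exp (l * s) * exp ((p - 2) * l * s) = exp (l * s) powr (p - 1)"
    by (simp add: powr_def algebra_simps flip: exp_add)
  ultimately have "((\<lambda>s. exp (l * s) *\<^sub>R u (T s)) has_vector_derivative
      l *\<^sub>R (exp (l * s) *\<^sub>R u (T s)) - exp (l * s) powr (p - 1) *\<^sub>R z) (at s within {s..})"
    by (simp add: o_def)
  moreover have "exp (l * s) powr (p - 1) *\<^sub>R z \<in> subdiff J (exp (l * s) *\<^sub>R u (T s))"
    by (intro homogeneous_subdiff[OF hom _ z]) simp
  ultimately show "\<exists>\<eta>\<in>subdiff J (exp (l * s) *\<^sub>R u (d + rescaled_time p l s)).
      ((\<lambda>s. exp (l * s) *\<^sub>R u (d + rescaled_time p l s)) has_vector_derivative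
        l *\<^sub>R exp (l * s) *\<^sub>R u (d + rescaled_time p l s) - \<eta>) (at s within {s..})"
    unfolding T_def by blast
qed

text \<open>The velocity is orthogonal to the null set, so the component along \<open>n\<close> is
  constant for positive times, and continuity at 0 identifies it. This keeps the flow orthogonal to
  the null set.\<close>

lemma grad_flow_inner_null:
  assumes flow: "grad_flow J f u" and conv: "convex_fun J" and hom: "abs_homogeneous p J"
    and fin: "\<And>t. t > 0 \<Longrightarrow> \<bar>J (u t)\<bar> \<noteq> \<infinity>" and n: "n \<in> null_set J" and t: "t > 0"
  shows "u t \<bullet> n = f \<bullet> n"
proof -
  have cu: "continuous_on {0..} u" and u0: "u 0 = f" using flow by (auto simp: grad_flow_def)
  have der: "((\<lambda>s. c * (u s \<bullet> n)) has_vector_derivative 0) (at x within {x..})" if x: "x > 0" for c x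
  proof -
    obtain z where z: "z \<in> subdiff J (u x)" "(u has_vector_derivative - z) (at x within {x..})"
      using flow x unfolding grad_flow_def min_norm_elem_def by blast
    have "((\<lambda>s. c * (u s \<bullet> n)) has_vector_derivative c * (- z \<bullet> n)) (at x within {x..})"
      using bounded_linear.has_vector_derivative[OF bounded_linear_mult_right[of c]
          bounded_linear.has_vector_derivative[OF bounded_linear_inner_left[of n] z(2)]] .
    then show ?thesis using subdiff_orthogonal_null[OF conv hom z(1) fin[OF x] n] by simp
  qed
  \<comment> \<open>The values 1 and -1 of \<open>c\<close> turn monotonicity into
    constancy.\<close>
  have le: "c * (u t \<bullet> n) \<le> c * (u r \<bullet> n)" if r: "0 < r" "r \<le> t" for c r
  proof (rule right_vector_derivative_nonpos_imp_le[OF r(2)])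
    show "continuous_on {r..t} (\<lambda>s. c * (u s \<bullet> n))"
      using r by (intro continuous_intros continuous_on_subset[OF cu]) auto
    show "\<exists>d\<le>0. ((\<lambda>s. c * (u s \<bullet> n)) has_vector_derivative d) (at x within {x..})"
      if "r \<le> x" for x
      using der[of x c] r that by (intro exI[of _ 0]) auto
  qed
  have eq: "u r \<bullet> n = u t \<bullet> n" if "0 < r" "r \<le> t" for r
    using le[OF that, of 1] le[OF that, of "-1"] by simp
  have "(u \<longlongrightarrow> u 0) (at 0 within {0..})" using cu by (simp add: continuous_on_def)
  then have "(u \<longlongrightarrow> f) (at_right 0)" unfolding u0 by (rule tendsto_within_subset) auto
  then have lim: "((\<lambda>r. u r \<bullet> n) \<longlongrightarrow> f \<bullet> n) (at_right 0)" by (intro tendsto_intros)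
  have "\<forall>\<^sub>F r in at_right 0. r \<in> {0<..<t}" using t by (intro eventually_at_right_real)
  then have "\<forall>\<^sub>F r in at_right 0. u r \<bullet> n = u t \<bullet> n"
    by eventually_elim (rule eq, simp_all)
  then have "((\<lambda>r. u r \<bullet> n) \<longlongrightarrow> u t \<bullet> n) (at_right 0)"
    by (rule tendsto_eventually)
  with lim show ?thesis by (intro tendsto_unique[OF trivial_limit_at_right_real])
qed

section \<open>Positivity of the rate and the lower bound on the norm\<close>

text \<open>Excludes the default \<open>real_of_ereal \<infinity> = 0\<close>, which would make the
  rate \<open>lam\<close> of the theorem vanish.\<close>

lemma lambda1_finite:
  assumes "w \<in> H0 J" "J w < \<infinity>" "J w \<ge> 0"
  shows "lambda1 p J < \<infinity>"
proof -
  have "lambda1 p J \<le> ereal p * J w / ereal (norm w powr p)"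
    unfolding lambda1_def using assms(1) by (rule INF_lower)
  also have "\<dots> < \<infinity>"
  proof -
    have "norm w powr p \<noteq> 0" using assms(1) by (simp add: H0_def)
    then show ?thesis using assms(2,3) by (cases "J w") auto
  qed
  finally show ?thesis .
qed

text \<open>Rescaling with a rate \<open>m\<close> so large that the energy at time \<open>d\<close> is negative, monotonicity keeps
  the energy, hence the norm of the rescaled solution, away from 0.\<close>

lemma (in nonneg_lsc_zero) grad_flow_lower_bound:
  assumes flow: "grad_flow J f u" and hom: "abs_homogeneous p J" and p: "p > 2"
    and d: "d > 0" and ud: "u d \<noteq> 0" and l: "l > 0"
  obtains c where "c > 0" "\<And>t. t \<ge> d \<Longrightarrow> c * decay_rate p l t \<le> norm (u t)"
proof -
  define j where "j = real_of_ereal (J (u d))"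
  have j0: "j \<ge> 0" using nonneg by (simp add: j_def real_of_ereal_pos)
  \<comment> \<open>The added fraction contributes \<open>j + 1/2\<close> to
    \<open>m / 2 * (norm (u d))\<^sup>2\<close>, which pushes the energy at time \<open>d\<close> to
    at most \<open>- 1/2\<close>.\<close>
  define m where "m = l + (2 * j + 1) / (norm (u d))\<^sup>2"
  have ml: "m \<ge> l" using j0 by (simp add: m_def)
  then have m: "m > 0" using l by simp
  have "m / 2 * (norm (u d))\<^sup>2 = l / 2 * (norm (u d))\<^sup>2 + j + 1/2"
    using ud by (simp add: m_def field_simps)
  moreover have "l / 2 * (norm (u d))\<^sup>2 \<ge> 0" using l by simp
  ultimately have neg: "rescaled_energy J m (u d) \<le> - (1/2)"
    unfolding rescaled_energy_def j_def[symmetric] by linarith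
  define W where "W s = exp (m * s) *\<^sub>R u (d + rescaled_time p m s)" for s
  have Wflow: "rescaled_flow J m W 0"
    unfolding W_def using p d m by (intro rescaled_flow_of_grad_flow[OF flow hom]) auto
  have Wbound: "1 / sqrt m \<le> norm (W s)" if s: "s \<ge> 0" for s
  proof -
    have "rescaled_energy J m (W s) \<le> - (1/2)"
      using rescaled_energy_antimono[OF Wflow m order_refl s] neg by (simp add: W_def)
    moreover have "real_of_ereal (J (W s)) \<ge> 0" using nonneg by (simp add: real_of_ereal_pos)
    ultimately have "1/2 \<le> m / 2 * (norm (W s))\<^sup>2" unfolding rescaled_energy_def by linarith
    then have "1 / m \<le> (norm (W s))\<^sup>2" using m by (simp add: field_simps)
    then have "sqrt (1 / m) \<le> norm (W s)" by (intro real_le_lsqrt) auto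
    then show ?thesis by (simp add: real_sqrt_divide)
  qed
  \<comment> \<open>The first factor is the bound on \<open>W\<close>, the second converts decay at
    rate \<open>m\<close> into decay at rate \<open>l\<close>. For \<open>p > 2\<close> both rates
    give the same power of t; for exponentials no such constant would exist when
    \<open>m > l\<close>.\<close>
  define c where "c = 1 / sqrt m * (m / l) powr (- 1 / (p - 2))"
  have "c > 0" using m l by (simp add: c_def)
  moreover have "c * decay_rate p l t \<le> norm (u t)" if t: "t \<ge> d" for t
  proof -
    define s where "s = - ln (decay_rate p m (t - d)) / m"
    have Ts: "rescaled_time p m s = t - d"
      unfolding s_def using p m t by (intro rescaled_time_decay_rate) auto
    then have "s \<ge> 0" using rescaled_time_le_iff[OF m, of p 0 s] t by simp
    have apos: "decay_rate p m (t - d) > 0" using p m t by (intro decay_rate_pos) auto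
    have "exp (m * s) = 1 / decay_rate p m (t - d)"
      unfolding s_def using p m t by (intro exp_decay_rate) auto
    then have "norm (u t) = norm (W s) * decay_rate p m (t - d)"
      using apos by (simp add: W_def Ts)
    then have 1: "1 / sqrt m * decay_rate p m (t - d) \<le> norm (u t)"
      using mult_right_mono[OF Wbound[OF \<open>s \<ge> 0\<close>], of "decay_rate p m (t - d)"] apos by simp
    have "1 + (p - 2) * m * (t - d) \<le> m / l * (1 + (p - 2) * l * t)"
    proof -
      have "(p - 2) * m * (t - d) \<le> (p - 2) * m * t" using p m d by (intro mult_left_mono) auto
      moreover have "1 \<le> m / l" using ml l by simp
      moreover have "m / l * (1 + (p - 2) * l * t) = m / l + (p - 2) * m * t"
        using l by (simp add: field_simps)
      ultimately show ?thesis by linarith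
    qed
    moreover have "0 < 1 + (p - 2) * m * (t - d)" using p m t by (simp add: add_pos_nonneg)
    ultimately have "(m / l * (1 + (p - 2) * l * t)) powr (- 1 / (p - 2))
        \<le> (1 + (p - 2) * m * (t - d)) powr (- 1 / (p - 2))"
      using p by (intro powr_mono2') auto
    moreover have "(m / l * (1 + (p - 2) * l * t)) powr (- 1 / (p - 2))
        = (m / l) powr (- 1 / (p - 2)) * decay_rate p l t"
      using p l m d t by (subst powr_mult) (auto simp: decay_rate_def)
    ultimately have "(m / l) powr (- 1 / (p - 2)) * decay_rate p l t \<le> decay_rate p m (t - d)"
      using p by (simp add: decay_rate_def)
    then have "1 / sqrt m * ((m / l) powr (- 1 / (p - 2)) * decay_rate p l t)
        \<le> 1 / sqrt m * decay_rate p m (t - d)"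
      using m by (intro mult_left_mono) auto
    with 1 show ?thesis by (simp add: c_def mult.assoc)
  qed
  ultimately show ?thesis by (rule that)
qed

section \<open>Transfer of the limit results to the original time\<close>

theorem theorem4:
  fixes J :: "'a::{real_inner, complete_space} \<Rightarrow> ereal"
    and p :: real and f w_star :: 'a and u :: "real \<Rightarrow> 'a" and tk :: "nat \<Rightarrow> real"
  assumes J_convex: "convex_fun J"
    and J_lsc: "lsc_fun J"
    and J_proper: "proper_fun J"
    and J_dense: "closure (dom_fun J) = UNIV"
    and J_hom: "abs_homogeneous p J"
    and coercive: "lambda1 p J > 0"
    and p_ge: "p \<ge> 2"
    and f_in: "f \<in> H0 J"
    and flow: "grad_flow J f u"
  defines "lam \<equiv> real_of_ereal (lambda1 p J) * norm f powr (p - 2)"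
  defines "a \<equiv> (\<lambda>t::real. if p > 2 then (1 + (p - 2) * lam * t) powr (- 1 / (p - 2))
                           else exp (- lam * t))"
  defines "w \<equiv> (\<lambda>t. (1 / a t) *\<^sub>R u t)"
  assumes tk_lim: "filterlim tk at_top sequentially"
    and conv: "(\<lambda>k. w (tk k)) \<longlonglongrightarrow> w_star"
  shows "lam *\<^sub>R w_star \<in> subdiff J w_star \<and> (p > 2 \<longrightarrow> w_star \<noteq> 0)"
proof -
  have a_eq: "a = decay_rate p lam" by (simp add: a_def decay_rate_def fun_eq_iff)
  interpret nonneg_lsc_zero J
    using J_lsc abs_homogeneous_nonneg[OF J_convex J_hom] J_hom
    by unfold_locales (auto simp: abs_homogeneous_def)
  have fin: "\<bar>J (u t)\<bar> \<noteq> \<infinity>" if t: "t > 0" for t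
  proof -
    obtain z where "z \<in> subdiff J (u t)"
      using flow t unfolding grad_flow_def min_norm_elem_def by blast
    then show ?thesis by (rule finite_subdiff)
  qed
  have f0: "f \<noteq> 0" using f_in by (simp add: H0_def)
  \<comment> \<open>\<open>J f\<close> may be infinite, so a small positive time \<open>d\<close>
    with \<open>u d \<noteq> 0\<close> supplies the element of \<open>H0 J\<close> with finite
    energy.\<close>
  have "(u \<longlongrightarrow> f) (at 0 within {0..})"
    using flow by (auto simp: grad_flow_def continuous_on_def)
  then have "(u \<longlongrightarrow> f) (at_right 0)" by (rule tendsto_within_subset) auto
  then have "\<forall>\<^sub>F d in at_right 0. u d \<noteq> 0" using f0 by (rule tendsto_imp_eventually_ne)
  moreover have "\<forall>\<^sub>F d in at_right 0. (0::real) < d" by (rule eventually_at_right_less)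
  ultimately have "\<forall>\<^sub>F d in at_right 0. 0 < d \<and> u d \<noteq> 0" by eventually_elim simp
  then obtain d where d: "d > 0" "u d \<noteq> 0"
    using eventually_happens trivial_limit_at_right_real by blast
  have "u d \<in> H0 J"
    using d(2) f_in by (simp add: H0_def grad_flow_inner_null[OF flow J_convex J_hom fin _ d(1)])
  then have "lambda1 p J < \<infinity>"
    using fin[OF d(1)] nonneg[of "u d"] by (intro lambda1_finite) auto
  then have "real_of_ereal (lambda1 p J) > 0" using coercive by (simp add: zero_less_real_of_ereal)
  then have lam: "lam > 0" using f0 by (simp add: lam_def)
  define W where "W s = exp (lam * s) *\<^sub>R u (0 + rescaled_time p lam s)" for s
  \<comment> \<open>Without a time shift the rescaled flow is started at logarithmic time 1, away
    from the initial time.\<close>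
  have Wflow: "rescaled_flow J lam W 1"
    unfolding W_def by (rule rescaled_flow_of_grad_flow[OF flow J_hom p_ge lam]) auto
  define sk where "sk k = - ln (a (tk k)) / lam" for k
  have tk_ge: "\<forall>\<^sub>F k in sequentially. r \<le> tk k" for r
    using tk_lim by (simp add: filterlim_at_top)
  have time: "rescaled_time p lam (sk k) = tk k" if "tk k \<ge> 0" for k
    unfolding sk_def a_eq using rescaled_time_decay_rate[OF p_ge lam that] .
  \<comment> \<open>\<open>rescaled_time p lam\<close> is strictly increasing and maps
    \<open>sk k\<close> to \<open>tk k\<close> once \<open>tk k\<close> is nonnegative.\<close>
  have "filterlim sk at_top sequentially"
    unfolding filterlim_at_top
  proof
    fix r
    show "\<forall>\<^sub>F k in sequentially. r \<le> sk k"
      using tk_ge[of 0] tk_ge[of "rescaled_time p lam r"]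
    proof eventually_elim
      case (elim k)
      then have "rescaled_time p lam r \<le> rescaled_time p lam (sk k)" by (simp only: time)
      then show ?case by (simp only: rescaled_time_le_iff[OF lam])
    qed
  qed
  moreover have "(\<lambda>k. W (sk k)) \<longlonglongrightarrow> w_star"
  proof (rule Lim_transform_eventually[OF conv])
    show "\<forall>\<^sub>F k in sequentially. w (tk k) = W (sk k)"
      using tk_ge[of 0]
    proof eventually_elim
      case (elim k)
      then show ?case
        using time[OF elim] exp_decay_rate[OF p_ge lam elim]
        unfolding W_def w_def sk_def a_eq by simp
    qed
  qed
  ultimately have "lam *\<^sub>R w_star \<in> subdiff J w_star"
    by (rule rescaled_flow_limit_eigenvector[OF Wflow lam])
  moreover have "w_star \<noteq> 0" if p: "p > 2"
  proof -
    obtain c where c: "c > 0" and cb: "\<And>t. t \<ge> d \<Longrightarrow> c * decay_rate p lam t \<le> norm (u t)"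
      using grad_flow_lower_bound[OF flow J_hom p d lam] by blast
    have "\<forall>\<^sub>F k in sequentially. c \<le> norm (w (tk k))"
      using tk_ge[of d]
    proof eventually_elim
      case (elim k)
      have "a (tk k) > 0"
        unfolding a_eq using p_ge lam elim d by (intro decay_rate_pos) auto
      then show ?case using cb[OF elim] by (simp add: w_def a_eq field_simps)
    qed
    then have "c \<le> norm w_star"
      by (intro tendsto_lowerbound[OF tendsto_norm[OF conv]]) simp_all
    then show ?thesis using c by auto
  qed
  ultimately show ?thesis by blast
qed

end
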